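(* Let $G$ and $G'$ be two graphs on the same set $V$ of $v$ vertices (possibly infinite). Let $k$ be an integer with $3\leq k\leq v-2$ and $k\equiv 3 \pmod 4$. Then the following are equivalent: (i) for all $k$-element subsets $K$ of $V$, $e(G_{\restriction K})$ has the same parity as $e(G'_{\restriction K})$, and $G_{\restriction K}$, $G'_{\restriction K}$ have the same $3$-homogeneous subsets; (ii) $G'=G$.
   Context: Graphs are simple undirected graphs; $G_{\restriction K}$ is the induced subgraph on $K$ and $e(H)$ is the number of edges of $H$. A $3$-element vertex subset is a $3$-homogeneous subset of a graph $H$ if it induces a triangle in $H$ or in its complement (all three pairs are edges, or none). *)

theory Defs
  imports "HOL-Library.Ramsey"
begin

text \<open>
  A graph is a pair of a (possibly infinite) vertex set and a set of edges, which are
  two-element sets of vertices. \<^term>\<open>nsets A n\<close>, written \<open>[A]\<^bsup>n\<^esup>\<close>, is the set of \<open>n\<close>-element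
  subsets of \<open>A\<close>.
\<close>

type_synonym 'a ugraph = "'a set \<times> 'a set set"

abbreviation verts :: "'a ugraph \<Rightarrow> 'a set" where
  "verts G \<equiv> fst G"

abbreviation edges :: "'a ugraph \<Rightarrow> 'a set set" where
  "edges G \<equiv> snd G"

definition simple_graph :: "'a ugraph \<Rightarrow> bool" where
  "simple_graph G \<longleftrightarrow> edges G \<subseteq> nsets (verts G) 2"

text \<open>Intended for \<^prop>\<open>K \<subseteq> verts G\<close>.\<close>
definition induced :: "'a ugraph \<Rightarrow> 'a set \<Rightarrow> 'a ugraph" where
  "induced G K = (K, edges G \<inter> nsets K 2)"

definition complement :: "'a ugraph \<Rightarrow> 'a ugraph" where
  "complement G = (verts G, nsets (verts G) 2 - edges G)"

text \<open>Meaningful only for finitely many edges, since \<^const>\<open>card\<close> of an infinite set is 0.\<close>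
definition num_edges :: "'a ugraph \<Rightarrow> nat" where
  "num_edges G = card (edges G)"

definition triangle :: "'a ugraph \<Rightarrow> 'a set \<Rightarrow> bool" where
  "triangle G T \<longleftrightarrow> T \<in> nsets (verts G) 3 \<and> nsets T 2 \<subseteq> edges G"

definition homogeneous3 :: "'a ugraph \<Rightarrow> 'a set set" where
  "homogeneous3 G = {T. triangle G T \<or> triangle (complement G) T}"

end

theory Submission
  imports Defs
begin

text \<open>
  Let \<open>D\<close> be the symmetric difference of the two edge sets, so that every \<open>k\<close>-set spans an even
  number of \<open>D\<close>-edges. Comparing four \<open>k\<close>-sets that share \<open>k - 2\<close> vertices shows that every 4-cycle
  has an even number of edges in \<open>D\<close>, hence the parity of the number of \<open>D\<close>-edges is the same for all
  triples. If it were odd, \<open>D\<close> would be a disjoint union of two cliques, and these span an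
  odd number of edges on each \<open>k\<close>-set when \<open>k mod 4 = 3\<close>. So it is even and \<open>D\<close> is complete bipartite.
  If \<open>D\<close> is nonempty then, as there are at least five vertices, some vertex \<open>x\<close> has three
  \<open>D\<close>-neighbours on the other side. Two of these have the same \<open>G\<close>-adjacency to \<open>x\<close>, and together
  with \<open>x\<close> they form a triple that is homogeneous in exactly one of the two graphs.
\<close>

section \<open>Edge counts inside a set and choice of vertex subsets\<close>

lemma nsets_insert_2: "x \<notin> A \<Longrightarrow> nsets (insert x A) 2 = (\<lambda>y. {x, y}) ` A \<union> nsets A 2"
  by (auto simp: nsets_2_eq doubleton_eq_iff)

lemma nsets_triple_2:
  assumes "distinct [x, y, z]"
  shows "nsets {x, y, z} 2 = {{x, y}, {y, z}, {x, z}}"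
  using assms by (auto simp: nsets_2_eq)

lemma card_inter_nsets_insert_2:
  assumes "finite A" "x \<notin> A"
  shows "card (D \<inter> nsets (insert x A) 2) = card (D \<inter> nsets A 2) + card {y \<in> A. {x, y} \<in> D}"
proof -
  have "D \<inter> nsets (insert x A) 2 = D \<inter> nsets A 2 \<union> (\<lambda>y. {x, y}) ` {y \<in> A. {x, y} \<in> D}"
    using assms by (auto simp: nsets_insert_2)
  moreover have "inj_on (\<lambda>y. {x, y}) {y \<in> A. {x, y} \<in> D}"
    by (auto simp: inj_on_def doubleton_eq_iff)
  moreover have "D \<inter> nsets A 2 \<inter> (\<lambda>y. {x, y}) ` {y \<in> A. {x, y} \<in> D} = {}"
    using assms by (auto simp: nsets_def)
  moreover have "finite (nsets A 2)"
    using assms by (simp add: finite_imp_finite_nsets)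
  ultimately show ?thesis
    using assms by (simp add: card_Un_disjoint card_image)
qed

lemma card_inter_nsets_insert_insert_2:
  assumes "finite A" "x \<notin> A" "y \<notin> A" "x \<noteq> y"
  shows "card (D \<inter> nsets (insert x (insert y A)) 2) =
    card (D \<inter> nsets A 2) + card {z \<in> A. {x, z} \<in> D} + card {z \<in> A. {y, z} \<in> D}
      + of_bool ({x, y} \<in> D)"
proof -
  have "{z \<in> insert y A. {x, z} \<in> D}
      = (if {x, y} \<in> D then insert y {z \<in> A. {x, z} \<in> D} else {z \<in> A. {x, z} \<in> D})"
    by auto
  then show ?thesis
    using assms by (simp add: card_inter_nsets_insert_2)
qed

text \<open>Since \<open>card\<close> is 0 on infinite sets, size bounds on \<open>V\<close> are
  demanded only when \<open>V\<close> is finite, here and below.\<close>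

lemma subset_avoiding:
  assumes "finite V \<longrightarrow> n + card F \<le> card V" "finite F"
  obtains R where "R \<subseteq> V - F" "finite R" "card R = n"
proof (cases "finite V")
  case True
  then have "n \<le> card (V - F)"
    using assms diff_card_le_card_Diff[of F V] by simp
  then show ?thesis
    using that by (metis obtain_subset_with_card_n)
next
  case False
  then show ?thesis
    using that assms infinite_arbitrarily_large[of "V - F" n] by auto
qed

lemma nsets_superset:
  assumes "finite V \<longrightarrow> k \<le> card V" "finite F" "F \<subseteq> V" "card F \<le> k"
  obtains K where "K \<in> nsets V k" "F \<subseteq> K"
proof -
  have "finite V \<longrightarrow> k - card F + card F \<le> card V"
    using assms by simp
  then obtain R where R: "R \<subseteq> V - F" "finite R" "card R = k - card F"
    using subset_avoiding assms(2) by metis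
  moreover from R have "card (F \<union> R) = card F + card R"
    using assms(2) by (intro card_Un_disjoint) auto
  ultimately have "F \<union> R \<in> nsets V k"
    using assms by (auto simp: nsets_def)
  then show thesis
    using that by blast
qed

section \<open>Parity on 4-cycles and triples\<close>

lemma even_4_cycle:
  assumes even: "\<And>K. K \<in> nsets V k \<Longrightarrow> even (card (D \<inter> nsets K 2))"
    and "2 \<le> k" "finite V \<longrightarrow> k + 2 \<le> card V"
    and V: "x \<in> V" "y \<in> V" "z \<in> V" "w \<in> V" and dist: "distinct [x, y, z, w]"
  shows "({x, z} \<in> D \<longleftrightarrow> {y, z} \<in> D) \<longleftrightarrow> ({x, w} \<in> D \<longleftrightarrow> {y, w} \<in> D)"
proof -
  obtain R where R: "R \<subseteq> V - {x, y, z, w}" "finite R" "card R = k - 2"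
    using subset_avoiding[of V "k - 2" "{x, y, z, w}"] assms by auto
  \<comment> \<open>Modulo 2, membership of \<open>{a, b}\<close> is a constant plus a term in
    \<open>a\<close> plus a term in \<open>b\<close>, because \<open>R\<close> is the same for all
    four pairs. Around the 4-cycle each term occurs an even number of times and cancels.\<close>
  have "{a, b} \<in> D \<longleftrightarrow>
      odd (card (D \<inter> nsets R 2) + card {c \<in> R. {a, c} \<in> D} + card {c \<in> R. {b, c} \<in> D})"
    if "a \<in> {x, y}" "b \<in> {z, w}" for a b
  proof -
    have "a \<notin> R" "b \<notin> R" "a \<noteq> b" "a \<in> V" "b \<in> V"
      using that R V dist by auto
    moreover from this have "insert a (insert b R) \<in> nsets V k"
      using R \<open>2 \<le> k\<close> by (auto simp: nsets_def)
    ultimately show ?thesis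
      using even[of "insert a (insert b R)"] R
      by (cases "{a, b} \<in> D") (simp_all add: card_inter_nsets_insert_insert_2)
  qed
  from this[of x z] this[of y z] this[of x w] this[of y w] show ?thesis
    by simp argo
qed

text \<open>Up to order the residues of \<open>a\<close> and \<open>b\<close> mod 4 are 0, 3 or 1,
  2. In both cases exactly one binomial coefficient is odd.\<close>

lemma odd_choose_2_two_parts:
  assumes "(a + b) mod 4 = (3::nat)"
  shows "odd ((a choose 2) + (b choose 2))"
proof -
  have choose: "even (n choose 2) \<longleftrightarrow> n mod 4 = 0 \<or> n mod 4 = 1" for n :: nat
  proof -
    define q where "q = n div 4"
    have "n = 4 * q + n mod 4" by (simp add: q_def)
    moreover have "n mod 4 = 0 \<or> n mod 4 = 1 \<or> n mod 4 = 2 \<or> n mod 4 = 3" by presburger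
    ultimately consider "n = 4 * q" | "n = 4 * q + 1" | "n = 4 * q + 2" | "n = 4 * q + 3"
      by fastforce
    then show ?thesis
    proof cases
      case 1
      have "n choose 2 = 2 * (q * (4 * q - 1))"
        unfolding choose_two 1 by simp
      then show ?thesis using 1 by simp
    next
      case 2
      have "n choose 2 = 2 * (q * (4 * q + 1))"
        unfolding choose_two 2 by simp
      then show ?thesis using 2 by simp
    next
      case 3
      have "n * (n - 1) = 2 * (2 * (4 * q * q + 3 * q) + 1)"
        unfolding 3 by (simp add: algebra_simps)
      then have "n choose 2 = 2 * (4 * q * q + 3 * q) + 1"
        unfolding choose_two by simp
      moreover have "n mod 4 = 2" using 3 by presburger
      ultimately show ?thesis by simp
    next
      case 4
      have "n * (n - 1) = 2 * (2 * (4 * q * q + 5 * q + 1) + 1)"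
        unfolding 4 by (simp add: algebra_simps)
      then have "n choose 2 = 2 * (4 * q * q + 5 * q + 1) + 1"
        unfolding choose_two by simp
      moreover have "n mod 4 = 3" using 4 by presburger
      ultimately show ?thesis by simp
    qed
  qed
  show ?thesis
    using assms by (simp only: even_add choose) presburger
qed

text \<open>If every triple has an odd number of pairs in \<open>D\<close>, then \<open>y\<close>
  and \<open>z\<close> are joined iff they relate to a fixed \<open>x\<close> in the same way, so
  \<open>D\<close> is two disjoint cliques on \<open>K\<close>.\<close>

lemma odd_edges_if_odd_triples:
  assumes "finite K" "card K mod 4 = 3"
    and odd: "\<And>x y z. \<lbrakk>x \<in> K; y \<in> K; z \<in> K; distinct [x, y, z]\<rbrakk> \<Longrightarrow>
      {x, y} \<in> D \<longleftrightarrow> ({x, z} \<in> D \<longleftrightarrow> {y, z} \<in> D)"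
  shows "odd (card (D \<inter> nsets K 2))"
proof -
  obtain x where x: "x \<in> K"
    using assms by fastforce
  \<comment> \<open>Counting \<open>x\<close> among its own neighbours makes \<open>D_iff\<close>
    hold for pairs containing \<open>x\<close> too.\<close>
  define A where "A = {y \<in> K. y = x \<or> {x, y} \<in> D}"
  define B where "B = K - A"
  have D_iff: "{y, z} \<in> D \<longleftrightarrow> (y \<in> A \<longleftrightarrow> z \<in> A)" if "y \<in> K" "z \<in> K" "y \<noteq> z" for y z
    using odd[of x y z] that x
    by (cases "y = x \<or> z = x") (auto simp: A_def insert_commute)
  have "D \<inter> nsets K 2 = nsets A 2 \<union> nsets B 2"
  proof (rule set_eqI)
    fix e
    have sub: "A \<subseteq> K" "B \<subseteq> K" by (auto simp: A_def B_def)
    show "e \<in> D \<inter> nsets K 2 \<longleftrightarrow> e \<in> nsets A 2 \<union> nsets B 2"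
    proof (cases "e \<in> nsets K 2")
      case True
      then obtain y z where "e = {y, z}" "y \<in> K" "z \<in> K" "y \<noteq> z"
        by (rule nsets2_E)
      then show ?thesis
        using D_iff[of y z] by (simp add: B_def) blast
    next
      case False
      then show ?thesis
        using nsets_mono[OF sub(1)] nsets_mono[OF sub(2)] by blast
    qed
  qed
  moreover have "nsets A 2 \<inter> nsets B 2 = {}"
    by (auto simp: nsets_2_eq B_def doubleton_eq_iff)
  moreover have fin: "finite A" "finite B" "A \<inter> B = {}" "K = A \<union> B"
    using \<open>finite K\<close> by (auto simp: A_def B_def)
  ultimately have "card (D \<inter> nsets K 2) = (card A choose 2) + (card B choose 2)"
    by (simp add: card_Un_disjoint finite_imp_finite_nsets)
  moreover have "(card A + card B) mod 4 = 3"
    using assms(2) fin by (simp add: card_Un_disjoint)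
  ultimately show ?thesis
    using odd_choose_2_two_parts by simp
qed

text \<open>A single odd triple would make all triples odd, by exchanging one vertex at a time, and
  then every \<open>k\<close>-set would span an odd number of pairs of \<open>D\<close>.\<close>

lemma even_triples:
  assumes even: "\<And>K. K \<in> nsets V k \<Longrightarrow> even (card (D \<inter> nsets K 2))"
    and k: "k mod 4 = 3" and V: "finite V \<longrightarrow> k + 2 \<le> card V"
    and xyz: "x \<in> V" "y \<in> V" "z \<in> V" "distinct [x, y, z]"
  shows "{x, y} \<in> D \<longleftrightarrow> ({x, z} \<in> D \<longleftrightarrow> {y, z} \<notin> D)"
proof (rule ccontr)
  assume neg: "\<not> ?thesis"
  define t where "t a b c \<longleftrightarrow> ({a, b} \<in> D \<longleftrightarrow> ({a, c} \<in> D \<longleftrightarrow> {b, c} \<in> D))" for a b c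
  have "2 \<le> k" using k by presburger
  have t_swap: "t a b c \<longleftrightarrow> t b a c" "t a b c \<longleftrightarrow> t a c b" for a b c
    by (auto simp: t_def insert_commute)
  \<comment> \<open>The pair \<open>{a, b}\<close> is common to both triples; what remains is the
    4-cycle \<open>a\<close>, \<open>c\<close>, \<open>b\<close>, \<open>d\<close>.\<close>
  have step: "t a b c \<longleftrightarrow> t a b d"
    if "{a, b, c, d} \<subseteq> V" "distinct [a, b, c]" "distinct [a, b, d]" for a b c d
  proof (cases "c = d")
    case False
    then show ?thesis
      using even_4_cycle[OF even \<open>2 \<le> k\<close> V, of a b c d] that
      by (auto simp: t_def)
  qed simp
  have "finite V \<longrightarrow> k \<le> card V"
    using V by linarith
  then obtain K where K: "K \<in> nsets V k"
    by (rule nsets_superset[of V k "{}"]) auto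
  have all: "t a b c" if "a \<in> V" "b \<in> V" "c \<in> V" "distinct [a, b, c]" for a b c
  proof -
    have "t x y z"
      using neg by (auto simp: t_def)
    \<comment> \<open>First only triples through \<open>x\<close>: replace \<open>z\<close> by
      \<open>p\<close>, then \<open>y\<close> by \<open>q\<close>. Any other triple is reached
      afterwards by replacing \<open>x\<close>.\<close>
    have x: "t x p q" if "p \<in> V" "q \<in> V" "distinct [x, p, q]" for p q
    proof (cases "p = y")
      case True
      then show ?thesis
        using step[of x y z q] \<open>t x y z\<close> that xyz by auto
    next
      case False
      then have "t x y p"
        using step[of x y z p] \<open>t x y z\<close> that xyz by auto
      then have "t x p y"
        using t_swap by blast
      then show ?thesis
        using step[of x p y q] that xyz False by auto
    qed
    show ?thesis
    proof (cases "x \<in> {a, b, c}")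
      case True
      then show ?thesis
        using x[of b c] x[of a c] x[of a b] t_swap that by auto
    next
      case False
      then have "t x a b"
        using x[of a b] that by auto
      then have "t a b x"
        using t_swap by blast
      then show ?thesis
        using step[of a b x c] that xyz False by auto
    qed
  qed
  have "odd (card (D \<inter> nsets K 2))"
  proof (rule odd_edges_if_odd_triples)
    show "finite K" "card K mod 4 = 3"
      using K k by (auto simp: nsets_def)
  next
    fix a b c assume "a \<in> K" "b \<in> K" "c \<in> K" "distinct [a, b, c]"
    then show "{a, b} \<in> D \<longleftrightarrow> ({a, c} \<in> D \<longleftrightarrow> {b, c} \<in> D)"
      using all[of a b c] K unfolding t_def nsets_def by blast
  qed
  with even[OF K] show False by simp
qed

section \<open>Homogeneous triples and the final argument\<close>

lemma even_card_symdiff: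
  assumes "finite A" "finite B"
  shows "even (card (A - B \<union> (B - A))) \<longleftrightarrow> (even (card A) \<longleftrightarrow> even (card B))"
proof -
  have "card (A - B \<union> (B - A)) = card (A - B) + card (B - A)"
    using assms by (intro card_Un_disjoint) auto
  moreover have "card A = card (A \<inter> B) + card (A - B)" "card B = card (B \<inter> A) + card (B - A)"
    using assms card_Int_Diff by blast+
  ultimately show ?thesis by (simp only: even_add Int_commute) argo
qed

text \<open>The right side does not mention \<open>K\<close>, so a triple can be tested in any
  \<open>k\<close>-set containing it.\<close>

lemma homogeneous3_induced_iff:
  assumes "x \<in> K" "y \<in> K" "z \<in> K" "distinct [x, y, z]"
  shows "{x, y, z} \<in> homogeneous3 (induced G K) \<longleftrightarrow>
    ({x, y} \<in> edges G \<longleftrightarrow> {x, z} \<in> edges G) \<and> ({x, y} \<in> edges G \<longleftrightarrow> {y, z} \<in> edges G)"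
proof -
  have "{x, y, z} \<in> nsets K 3" "{x, y} \<in> nsets K 2" "{x, z} \<in> nsets K 2" "{y, z} \<in> nsets K 2"
    using assms by (auto simp: nsets_def)
  then show ?thesis
    using assms
    by (auto simp: homogeneous3_def triangle_def induced_def complement_def nsets_triple_2)
qed

theorem theorem4p4:
  fixes V :: "'a set" and G G' :: "'a ugraph" and k :: nat
  assumes "simple_graph G" and "verts G = V"
    and "simple_graph G'" and "verts G' = V"
    and "3 \<le> k" and "finite V \<longrightarrow> k + 2 \<le> card V"
    and "k mod 4 = 3"
  shows "(\<forall>K \<in> nsets V k.
            (even (num_edges (induced G K)) \<longleftrightarrow> even (num_edges (induced G' K))) \<and>
            homogeneous3 (induced G K) = homogeneous3 (induced G' K))
         \<longleftrightarrow> G' = G"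
proof
  assume asm: "\<forall>K \<in> nsets V k.
            (even (num_edges (induced G K)) \<longleftrightarrow> even (num_edges (induced G' K))) \<and>
            homogeneous3 (induced G K) = homogeneous3 (induced G' K)"
  define E E' where "E = edges G" and "E' = edges G'"
  define D where "D = E - E' \<union> (E' - E)"
  have D_iff: "e \<in> D \<longleftrightarrow> (e \<in> E \<longleftrightarrow> e \<notin> E')" for e
    by (auto simp: D_def)
  have even: "even (card (D \<inter> nsets K 2))" if K: "K \<in> nsets V k" for K
  proof -
    have "finite (nsets K 2)"
      using K by (auto simp: nsets_def intro: finite_imp_finite_nsets)
    moreover have "D \<inter> nsets K 2
        = E \<inter> nsets K 2 - E' \<inter> nsets K 2 \<union> (E' \<inter> nsets K 2 - E \<inter> nsets K 2)"
      by (auto simp: D_def)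
    ultimately show ?thesis
      using asm K even_card_symdiff[of "E \<inter> nsets K 2" "E' \<inter> nsets K 2"]
      by (simp add: num_edges_def induced_def E_def E'_def)
  qed
  have triple: "{x, y} \<in> D \<longleftrightarrow> ({x, z} \<in> D \<longleftrightarrow> {y, z} \<notin> D)"
    if "x \<in> V" "y \<in> V" "z \<in> V" "distinct [x, y, z]" for x y z
    using even_triples[OF even assms(7,6) that] .
  have hom: "({x, y} \<in> E \<longleftrightarrow> {x, z} \<in> E) \<and> ({x, y} \<in> E \<longleftrightarrow> {y, z} \<in> E) \<longleftrightarrow>
      ({x, y} \<in> E' \<longleftrightarrow> {x, z} \<in> E') \<and> ({x, y} \<in> E' \<longleftrightarrow> {y, z} \<in> E')"
    if xyz: "x \<in> V" "y \<in> V" "z \<in> V" "distinct [x, y, z]" for x y z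
  proof -
    have "finite V \<longrightarrow> k \<le> card V"
      using assms(6) by linarith
    moreover have "card {x, y, z} \<le> k"
      using xyz \<open>3 \<le> k\<close> by simp
    ultimately obtain K where K: "K \<in> nsets V k" "{x, y, z} \<subseteq> K"
      using xyz nsets_superset[of V k "{x, y, z}"] by blast
    then have "homogeneous3 (induced G K) = homogeneous3 (induced G' K)"
      using asm by blast
    then show ?thesis
      using xyz K homogeneous3_induced_iff[of x K y z G] homogeneous3_induced_iff[of x K y z G']
      by (simp add: E_def E'_def)
  qed
  have no_3_nbrs: False
    if "x \<in> V" "a \<in> V" "b \<in> V" "c \<in> V" "distinct [x, a, b, c]"
      "{x, a} \<in> D" "{x, b} \<in> D" "{x, c} \<in> D" for x a b c
  proof -
    \<comment> \<open>By \<open>triple\<close>, \<open>{p, q}\<close> is not in \<open>D\<close>. If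
      \<open>{x, p}\<close> and \<open>{x, q}\<close> agreed in \<open>E\<close>, both would switch
      to the opposite status in \<open>E'\<close> while \<open>{p, q}\<close> keeps its own,
      contradicting \<open>hom\<close>.\<close>
    have "{x, p} \<in> E \<longleftrightarrow> {x, q} \<notin> E"
      if "p \<in> V" "q \<in> V" "distinct [x, p, q]" "{x, p} \<in> D" "{x, q} \<in> D" for p q
      using hom[of x p q] triple[of x p q] that \<open>x \<in> V\<close> by (auto simp: D_iff)
    from this[of a b] this[of b c] this[of a c] that show False
      by auto
  qed
  have "{x, b} \<notin> D" if "x \<in> V" "b \<in> V" "x \<noteq> b" for x b
  proof
    assume xb: "{x, b} \<in> D"
    have "finite V \<longrightarrow> 3 + card {x, b} \<le> card V"
      using assms(5,6) that by auto
    then obtain R where R: "R \<subseteq> V - {x, b}" "card R = 3"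
      by (rule subset_avoiding) auto
    then obtain p q r where "R = {p, q, r}" "distinct [p, q, r]"
      by (auto simp: card_3_iff)
    with R have pqr: "p \<in> V" "q \<in> V" "r \<in> V" "distinct [x, b, p, q, r]"
      using that by auto
    \<comment> \<open>Each of \<open>p\<close>, \<open>q\<close>, \<open>r\<close> is joined in
      \<open>D\<close> to exactly one of \<open>x\<close> and \<open>b\<close>, so one of these two
      gets at least two of them; the other end of \<open>{x, b}\<close> is its third
      neighbour.\<close>
    have "{x, s} \<in> D \<longleftrightarrow> {b, s} \<notin> D" if "s \<in> {p, q, r}" for s
      using triple[of x b s] \<open>x \<in> V\<close> \<open>b \<in> V\<close> pqr xb that by auto
    moreover have "{b, x} \<in> D"
      using xb by (simp add: insert_commute)
    ultimately show False
      using pqr that xb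
        no_3_nbrs[of x b p q] no_3_nbrs[of x b p r] no_3_nbrs[of x b q r]
        no_3_nbrs[of b x p q] no_3_nbrs[of b x p r] no_3_nbrs[of b x q r]
      by auto
  qed
  moreover have "D \<subseteq> nsets V 2"
    using assms by (auto simp: D_def E_def E'_def simple_graph_def)
  ultimately have "D = {}"
    by (fastforce simp: nsets_2_eq)
  then have "E' = E"
    by (auto simp: D_def)
  then show "G' = G"
    using assms by (simp add: E_def E'_def prod_eq_iff)
qed simp

end
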